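(* Let $R$ be a transit function on a non-empty finite set $V$ satisfying Axioms (b1'), (J2), (J4), (J4') and (TW1'). Then the underlying graph $G_R$ is AT-free.
   Context: A transit function on a set $V$ is a map $R:V\times V\to 2^V$ such that for all $u,v\in V$: $u\in R(u,v)$, $R(u,v)=R(v,u)$ and $R(u,u)=\{u\}$. The underlying graph $G_R$ has vertex set $V$, and distinct $u,v$ are adjacent iff $R(u,v)=\{u,v\}$. Three vertices form an asteroidal triple if each two of them are joined by a path containing no neighbor of the third; a graph is AT-free if it has no asteroidal triple. The axioms (all quantified over elements of $V$): (b1') If $x\in R(u,v)$, $v\neq x$ and $R(v,x)\neq\{v,x\}$, then $v\notin R(u,x)$. (J2) If $R(u,x)=\{u,x\}$, $R(x,v)=\{x,v\}$, $u\neq v$ and $R(u,v)\neq\{u,v\}$, then $x\in R(u,v)$. (J4) If $x\in R(u,y)$, $y\in R(x,v)$, $x\neq y$, $R(u,x)=\{u,x\}$, $R(y,v)=\{y,v\}$ and $R(u,v)\neq\{u,v\}$, then $x\in R(u,v)$. (J4') If $x\in R(u,y)$, $y\in R(x,v)$, $R(u,x)\neq\{u,x\}$, $R(y,v)\neq\{y,v\}$, $R(x,y)\neq\{x,y\}$ and $R(u,v)\neq\{u,v\}$, then $x\in R(u,v)$. (TW1') If $x,y\in R(u,v)$, $x\neq u$, $y\neq v$, $R(x,v)\neq\{x,v\}$, $R(u,y)\neq\{u,y\}$, $R(x,z)=\{x,z\}$, $R(z,w)=\{z,w\}$, $R(w,y)=\{w,y\}$ and $R(u,w)\neq\{u,w\}$,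 then $z\in R(u,v)$. *)

theory Defs
  imports "Graph_Theory.Graph_Theory"
begin

definition transit_function :: "'a set \<Rightarrow> ('a \<Rightarrow> 'a \<Rightarrow> 'a set) \<Rightarrow> bool" where
  "transit_function V R \<longleftrightarrow>
     (\<forall>u\<in>V. \<forall>v\<in>V. R u v \<subseteq> V \<and> u \<in> R u v \<and> R u v = R v u) \<and>
     (\<forall>u\<in>V. R u u = {u})"

text \<open>An undirected edge is represented by its two arcs, as usual for \<open>pair_graph\<close>.\<close>

definition underlying_graph :: "'a set \<Rightarrow> ('a \<Rightarrow> 'a \<Rightarrow> 'a set) \<Rightarrow> 'a pair_pre_digraph" where
  "underlying_graph V R =
     \<lparr> pverts = V, parcs = {(u, v). u \<in> V \<and> v \<in> V \<and> u \<noteq> v \<and> R u v = {u, v}} \<rparr>"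

lemma pair_graph_underlying_graph:
  assumes "finite V" "transit_function V R"
  shows "pair_graph (underlying_graph V R)"
proof -
  let ?A = "parcs (underlying_graph V R)"
  have "?A \<subseteq> V \<times> V"
    by (auto simp: underlying_graph_def)
  then have "finite ?A"
    using assms(1) by (meson finite_SigmaI finite_subset)
  moreover have "sym ?A"
    using assms(2) by (auto simp: underlying_graph_def transit_function_def sym_def)
  ultimately show ?thesis
    using assms(1) by unfold_locales (auto simp: underlying_graph_def symmetric_def)
qed

text \<open>
  Neighborhoods are open. Since the end vertices belong to the path, the three vertices of an
  asteroidal triple are automatically pairwise non-adjacent.
\<close>

definition joined_avoiding_neighbors :: "'a pair_pre_digraph \<Rightarrow> 'a \<Rightarrow> 'a \<Rightarrow> 'a \<Rightarrow> bool" where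
  "joined_avoiding_neighbors G u v w \<longleftrightarrow>
     (\<exists>p. vpath p (with_proj G) \<and> hd p = u \<and> last p = v \<and> (\<forall>x\<in>set p. (w, x) \<notin> parcs G))"

definition asteroidal_triple :: "'a pair_pre_digraph \<Rightarrow> 'a \<Rightarrow> 'a \<Rightarrow> 'a \<Rightarrow> bool" where
  "asteroidal_triple G u v w \<longleftrightarrow>
     {u, v, w} \<subseteq> pverts G \<and> distinct [u, v, w] \<and>
     joined_avoiding_neighbors G u v w \<and>
     joined_avoiding_neighbors G v w u \<and>
     joined_avoiding_neighbors G u w v"

definition AT_free :: "'a pair_pre_digraph \<Rightarrow> bool" where
  "AT_free G \<longleftrightarrow> \<not> (\<exists>u v w. asteroidal_triple G u v w)"

definition axiom_b1' :: "'a set \<Rightarrow> ('a \<Rightarrow> 'a \<Rightarrow> 'a set) \<Rightarrow> bool" where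
  "axiom_b1' V R \<longleftrightarrow>
     (\<forall>u\<in>V. \<forall>v\<in>V. \<forall>x\<in>V.
        x \<in> R u v \<and> v \<noteq> x \<and> R v x \<noteq> {v, x} \<longrightarrow> v \<notin> R u x)"

definition axiom_J2 :: "'a set \<Rightarrow> ('a \<Rightarrow> 'a \<Rightarrow> 'a set) \<Rightarrow> bool" where
  "axiom_J2 V R \<longleftrightarrow>
     (\<forall>u\<in>V. \<forall>v\<in>V. \<forall>x\<in>V.
        R u x = {u, x} \<and> R x v = {x, v} \<and> u \<noteq> v \<and> R u v \<noteq> {u, v} \<longrightarrow> x \<in> R u v)"

definition axiom_J4 :: "'a set \<Rightarrow> ('a \<Rightarrow> 'a \<Rightarrow> 'a set) \<Rightarrow> bool" where
  "axiom_J4 V R \<longleftrightarrow>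
     (\<forall>u\<in>V. \<forall>v\<in>V. \<forall>x\<in>V. \<forall>y\<in>V.
        x \<in> R u y \<and> y \<in> R x v \<and> x \<noteq> y \<and> R u x = {u, x} \<and> R y v = {y, v} \<and> R u v \<noteq> {u, v}
          \<longrightarrow> x \<in> R u v)"

definition axiom_J4' :: "'a set \<Rightarrow> ('a \<Rightarrow> 'a \<Rightarrow> 'a set) \<Rightarrow> bool" where
  "axiom_J4' V R \<longleftrightarrow>
     (\<forall>u\<in>V. \<forall>v\<in>V. \<forall>x\<in>V. \<forall>y\<in>V.
        x \<in> R u y \<and> y \<in> R x v \<and> R u x \<noteq> {u, x} \<and> R y v \<noteq> {y, v} \<and> R x y \<noteq> {x, y} \<and>
        R u v \<noteq> {u, v}
          \<longrightarrow> x \<in> R u v)"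

definition axiom_TW1' :: "'a set \<Rightarrow> ('a \<Rightarrow> 'a \<Rightarrow> 'a set) \<Rightarrow> bool" where
  "axiom_TW1' V R \<longleftrightarrow>
     (\<forall>u\<in>V. \<forall>v\<in>V. \<forall>x\<in>V. \<forall>y\<in>V. \<forall>z\<in>V. \<forall>w\<in>V.
        x \<in> R u v \<and> y \<in> R u v \<and> x \<noteq> u \<and> y \<noteq> v \<and>
        R x v \<noteq> {x, v} \<and> R u y \<noteq> {u, y} \<and>
        R x z = {x, z} \<and> R z w = {z, w} \<and> R w y = {w, y} \<and> R u w \<noteq> {u, w}
          \<longrightarrow> z \<in> R u v)"

end

theory Submission
  imports Defs
begin

text \<open>
  For an asteroidal triple \<open>u, v, w\<close> one shows \<open>w \<in> R u v\<close>; by symmetry \<open>v \<in> R u w\<close>,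
  which contradicts (b1'). By (TW1'), if \<open>R u v\<close> meets the component \<open>D\<close> of \<open>w\<close> in the graph
  without the closed neighborhoods of \<open>u\<close> and \<open>v\<close>, then it contains \<open>D\<close>. To see that it meets \<open>D\<close>,
  take a shortest walk \<open>f 0, \<dots>, f k\<close> in \<open>D\<close> such that \<open>f 0\<close> has a neighbor \<open>a\<close> adjacent to \<open>u\<close>
  but not to \<open>v\<close>, and \<open>f k\<close> has a neighbor \<open>b\<close> adjacent to \<open>v\<close> but not to \<open>u\<close>. The paths
  \<open>u, a, f 0, \<dots>, f k\<close> and \<open>f 0, \<dots>, f k, b, v\<close> are induced, and the first two inner vertices
  from each end of an induced path lie in the transit set of its end vertices. So for \<open>k \<ge> 2\<close> axiom (J4') gives
  \<open>f 0 \<in> R u v\<close>. For \<open>k \<le> 1\<close>, (J4) gives \<open>a, b \<in> R u v\<close>, and then (TW1') gives \<open>f 0 \<in> R u v\<close>.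
\<close>

locale transit_AT_axioms =
  fixes V :: "'a set" and R :: "'a \<Rightarrow> 'a \<Rightarrow> 'a set"
  assumes transit: "transit_function V R"
    and J2: "axiom_J2 V R"
    and J4: "axiom_J4 V R"
    and J4': "axiom_J4' V R"
    and TW1': "axiom_TW1' V R"
begin

text \<open>Adjacent or equal: the axioms only ever test this reflexive relation.\<close>

definition adj :: "'a \<Rightarrow> 'a \<Rightarrow> bool" where
  "adj x y \<longleftrightarrow> R x y = {x, y}"

lemma R_commute: "u \<in> V \<Longrightarrow> v \<in> V \<Longrightarrow> R u v = R v u"
  using transit by (auto simp: transit_function_def)

lemma adj_refl: "x \<in> V \<Longrightarrow> adj x x"
  using transit by (auto simp: transit_function_def adj_def)

lemma adj_commute: "u \<in> V \<Longrightarrow> v \<in> V \<Longrightarrow> adj u v \<longleftrightarrow> adj v u"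
  by (auto simp: adj_def R_commute)

lemma mem_R_J2:
  assumes "u \<in> V" "v \<in> V" "x \<in> V" "adj u x" "adj x v" "u \<noteq> v" "\<not> adj u v"
  shows "x \<in> R u v"
  using J2 assms by (auto simp: axiom_J2_def adj_def)

lemma mem_R_J4:
  assumes "u \<in> V" "v \<in> V" "x \<in> V" "y \<in> V" "x \<in> R u y" "y \<in> R x v" "x \<noteq> y"
    "adj u x" "adj y v" "\<not> adj u v"
  shows "x \<in> R u v"
  using J4 assms unfolding axiom_J4_def adj_def by blast

lemma mem_R_J4':
  assumes "u \<in> V" "v \<in> V" "x \<in> V" "y \<in> V" "x \<in> R u y" "y \<in> R x v"
    "\<not> adj u x" "\<not> adj y v" "\<not> adj x y" "\<not> adj u v"
  shows "x \<in> R u v"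
  using J4' assms unfolding axiom_J4'_def adj_def by blast

lemma mem_R_TW1':
  assumes "u \<in> V" "v \<in> V" "x \<in> V" "y \<in> V" "z \<in> V" "w \<in> V" "x \<in> R u v" "y \<in> R u v"
    "x \<noteq> u" "y \<noteq> v" "\<not> adj x v" "\<not> adj u y" "adj x z" "adj z w" "adj w y" "\<not> adj u w"
  shows "z \<in> R u v"
  using TW1' assms unfolding axiom_TW1'_def adj_def by blast

section \<open>Induced paths and the transit sets of their ends\<close>

text \<open>\<open>n\<close> counts edges. Values of \<open>p\<close> beyond index \<open>n\<close>
  are irrelevant, so a prefix is the same function with a smaller bound.\<close>

definition induced_path :: "nat \<Rightarrow> (nat \<Rightarrow> 'a) \<Rightarrow> bool" where
  "induced_path n p \<longleftrightarrow>
     (\<forall>i\<le>n. p i \<in> V) \<and> (\<forall>j\<le>n. \<forall>i<j. p i \<noteq> p j \<and> (adj (p i) (p j) \<longleftrightarrow> j = Suc i))"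

lemma induced_pathD:
  assumes "induced_path n p"
  shows "i \<le> n \<Longrightarrow> p i \<in> V"
    and "i < j \<Longrightarrow> j \<le> n \<Longrightarrow> p i \<noteq> p j"
    and "i < j \<Longrightarrow> j \<le> n \<Longrightarrow> adj (p i) (p j) \<longleftrightarrow> j = Suc i"
  using assms by (auto simp: induced_path_def)

lemma induced_path_prefix: "induced_path n p \<Longrightarrow> m \<le> n \<Longrightarrow> induced_path m p"
  by (auto simp: induced_path_def)

lemma induced_path_rev:
  assumes "induced_path n p"
  shows "induced_path n (\<lambda>i. p (n - i))"
  unfolding induced_path_def
proof (intro conjI allI impI)
  show "p (n - i) \<in> V" for i
    using assms by (auto intro: induced_pathD)
next
  fix i j assume "i < j" "j \<le> n"
  then have *: "n - j < n - i" "n - i \<le> n" "n - j \<le> n" by auto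
  show "p (n - i) \<noteq> p (n - j)"
    using induced_pathD(2)[OF assms *(1,2)] by simp
  have "adj (p (n - i)) (p (n - j)) \<longleftrightarrow> adj (p (n - j)) (p (n - i))"
    using induced_pathD(1)[OF assms] by (intro adj_commute) auto
  also have "\<dots> \<longleftrightarrow> n - i = Suc (n - j)"
    using induced_pathD(3)[OF assms *(1,2)] .
  also have "\<dots> \<longleftrightarrow> j = Suc i"
    using \<open>i < j\<close> \<open>j \<le> n\<close> by auto
  finally show "adj (p (n - i)) (p (n - j)) \<longleftrightarrow> j = Suc i" .
qed

lemma induced_path_Cons:
  assumes "induced_path n p" "x \<in> V" "x \<noteq> p 0" "adj x (p 0)"
    and "\<And>i. 0 < i \<Longrightarrow> i \<le> n \<Longrightarrow> \<not> adj x (p i)"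
  shows "induced_path (Suc n) (case_nat x p)"
proof -
  have "x \<noteq> p i" if "i \<le> n" for i
    using that assms adj_refl[of x] by (cases "i = 0") auto
  then show ?thesis
    using assms by (auto simp: induced_path_def split: nat.splits)
qed

text \<open>Strong induction on \<open>n\<close>: (J4) and (J4') combine what is known for a prefix
  and for a suffix, while (J2) and (TW1') handle short paths.\<close>

lemma induced_path_mem:
  assumes "induced_path n p"
  shows "2 \<le> n \<Longrightarrow> p 1 \<in> R (p 0) (p n)"
    and "3 \<le> n \<Longrightarrow> p 2 \<in> R (p 0) (p n)"
proof -
  have "(2 \<le> n \<longrightarrow> p 1 \<in> R (p 0) (p n)) \<and> (3 \<le> n \<longrightarrow> p 2 \<in> R (p 0) (p n))"
    using assms
  proof (induction n arbitrary: p rule: less_induct)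
    case (less n)
    note pV = induced_pathD(1)[OF less.prems]
      and neq = induced_pathD(2)[OF less.prems]
      and adj = induced_pathD(3)[OF less.prems]
    have fwd: "(2 \<le> m \<longrightarrow> q 1 \<in> R (q 0) (q m)) \<and> (3 \<le> m \<longrightarrow> q 2 \<in> R (q 0) (q m))"
      if "m < n" "induced_path n q" for m q
      using less.IH[OF that(1)] induced_path_prefix[OF that(2)] that(1) by simp
    \<comment> \<open>Reversing the path turns \<open>fwd\<close> into a statement about the last
      \<open>m\<close> edges.\<close>
    have bwd: "(2 \<le> m \<longrightarrow> q (n - 1) \<in> R (q (n - m)) (q n)) \<and>
               (3 \<le> m \<longrightarrow> q (n - 2) \<in> R (q (n - m)) (q n))"
      if "m < n" "induced_path n q" for m q
      using fwd[OF that(1) induced_path_rev[OF that(2)]] R_commute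
        induced_pathD(1)[OF that(2)] by simp
    \<comment> \<open>Stated for every \<open>q\<close>, since \<open>last\<close> arises from it by
      reversing \<open>p\<close>.\<close>
    have first: "q 1 \<in> R (q 0) (q n)" if q: "induced_path n q" and n: "2 \<le> n" for q
    proof (cases "n = 2")
      case True
      then show ?thesis
        using induced_pathD[OF q] by (intro mem_R_J2) auto
    next
      case False
      with n have "3 \<le> n" by simp
      have "q 1 \<in> R (q 0) (q (n - 1))"
        using fwd[of "n - 1" q] q \<open>3 \<le> n\<close> by simp
      moreover have "q (n - 1) \<in> R (q 1) (q n)"
        using bwd[of "n - 1" q] q \<open>3 \<le> n\<close> by simp
      ultimately show ?thesis
        using induced_pathD[OF q] \<open>3 \<le> n\<close>
        by (intro mem_R_J4[of "q 0" "q n" "q 1" "q (n - 1)"]) auto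
    qed
    have last: "p (n - 1) \<in> R (p 0) (p n)" if "2 \<le> n"
      using first[OF induced_path_rev[OF less.prems] that] R_commute pV by simp
    have "p 2 \<in> R (p 0) (p n)" if "3 \<le> n"
    proof -
      \<comment> \<open>For \<open>n = 3\<close> the vertex \<open>p 2\<close> is
        \<open>p (n - 1)\<close>. (J4') needs \<open>p 2\<close> and \<open>p (n - 2)\<close>
        distinct and non-adjacent, hence \<open>n \<ge> 6\<close>. In between, (TW1') runs along
        \<open>p 1\<close>, \<open>p 2\<close>, \<open>p 3\<close>, \<open>p (n - 1)\<close>, where
        the last two may coincide.\<close>
      consider "n = 3" | "n = 4 \<or> n = 5" | "6 \<le> n" using \<open>3 \<le> n\<close> by linarith
      then show ?thesis
      proof cases
        case 1
        then show ?thesis using last by simp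
      next
        case 2
        have "adj (p 3) (p (n - 1))"
          using 2 adj[of 3 4] adj_refl[OF pV[of 3]] by auto
        then show ?thesis
          using 2 pV neq[of 0 1] neq[of "n - 1" n] adj first[OF less.prems] last
          by (intro mem_R_TW1'[of "p 0" "p n" "p 1" "p (n - 1)" "p 2" "p 3"]) auto
      next
        case 3
        have "p 2 \<in> R (p 0) (p (n - 2))"
          using fwd[of "n - 2" p] less.prems 3 by simp
        moreover have "p (n - 2) \<in> R (p 2) (p n)"
          using bwd[of "n - 2" p] less.prems 3 by simp
        ultimately show ?thesis
          using pV adj 3 by (intro mem_R_J4'[of "p 0" "p n" "p 2" "p (n - 2)"]) auto
      qed
    qed
    with first[OF less.prems] show ?case by blast
  qed
  then show "2 \<le> n \<Longrightarrow> p 1 \<in> R (p 0) (p n)" "3 \<le> n \<Longrightarrow> p 2 \<in> R (p 0) (p n)" by auto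
qed

section \<open>Components away from closed neighborhoods\<close>

text \<open>As \<open>adj\<close> is reflexive, whole closed neighborhoods of \<open>S\<close> are
  removed. The reflexive transitive closure describes the components of what remains.\<close>

definition remote_edges :: "'a set \<Rightarrow> ('a \<times> 'a) set" where
  "remote_edges S =
     {(x, y). {x, y} \<subseteq> V \<and> x \<noteq> y \<and> adj x y \<and> (\<forall>s\<in>S. \<not> adj s x \<and> \<not> adj s y)}"

lemma remote_edges_rtrancl_sym:
  "(x, y) \<in> (remote_edges S)\<^sup>* \<Longrightarrow> (y, x) \<in> (remote_edges S)\<^sup>*"
proof -
  have "sym (remote_edges S)"
    using adj_commute by (auto simp: remote_edges_def sym_def)
  then show "(x, y) \<in> (remote_edges S)\<^sup>* \<Longrightarrow> (y, x) \<in> (remote_edges S)\<^sup>*"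
    by (blast dest: sym_rtrancl symD)
qed

text \<open>\<open>w\<close> stands for its component \<open>D\<close>. \<open>a0\<close> and
  \<open>b0\<close> witness that suitable walks exist; the proof picks its own \<open>a\<close> and
  \<open>b\<close> at the ends of a shortest one.\<close>

lemma remote_component_mem:
  assumes V: "u \<in> V" "v \<in> V" "w \<in> V" "a0 \<in> V" "b0 \<in> V" and uv: "\<not> adj u v"
    and w: "\<not> adj u w" "\<not> adj v w"
  defines "E \<equiv> remote_edges {u, v}"
  assumes a0: "adj u a0" "\<not> adj v a0" "adj a0 c0" "(w, c0) \<in> E\<^sup>*"
    and b0: "adj v b0" "\<not> adj u b0" "adj b0 d0" "(w, d0) \<in> E\<^sup>*"
  shows "w \<in> R u v"
proof -
  note symE = remote_edges_rtrancl_sym[of _ _ "{u, v}", folded E_def]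
  note E_def = E_def remote_edges_def
  have D: "x \<in> V \<and> \<not> adj u x \<and> \<not> adj v x" if "(w, x) \<in> E\<^sup>*" for x
    using that V w by (induction) (auto simp: E_def)
  have comm: "adj x y \<longleftrightarrow> adj y x" if "x \<in> V" "y \<in> V" for x y
    using adj_commute that .
  define end1 where "end1 c \<longleftrightarrow> (w, c) \<in> E\<^sup>* \<and> (\<exists>a\<in>V. adj u a \<and> \<not> adj v a \<and> adj a c)" for c
  define end2 where "end2 d \<longleftrightarrow> (w, d) \<in> E\<^sup>* \<and> (\<exists>b\<in>V. adj v b \<and> \<not> adj u b \<and> adj b d)" for d
  \<comment> \<open>The minimum also runs over the end vertices: this rules out chords as well as
    \<open>end1\<close> vertices after \<open>f 0\<close> and \<open>end2\<close> vertices before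
    \<open>f k\<close>.\<close>
  define conn where "conn k \<longleftrightarrow> (\<exists>c d. end1 c \<and> end2 d \<and> (c, d) \<in> E ^^ k)" for k
  have "end1 c0" "end2 d0" using a0 b0 V by (auto simp: end1_def end2_def)
  moreover have "(c0, d0) \<in> E\<^sup>*" using symE[OF a0(4)] b0(4) by (rule rtrancl_trans)
  ultimately have "\<exists>k. conn k" using rtrancl_imp_relpow unfolding conn_def by metis
  then obtain k where k: "conn k" and min: "\<And>m. m < k \<Longrightarrow> \<not> conn m"
    using exists_least_iff[of conn] by blast
  obtain c d where "end1 c" "end2 d" and cd: "(c, d) \<in> E ^^ k"
    using k by (auto simp: conn_def)
  obtain f where f0: "f 0 = c" and fk: "f k = d" and step: "\<And>i. i < k \<Longrightarrow> (f i, f (Suc i)) \<in> E"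
    using cd unfolding relpow_fun_conv by blast
  obtain a where a: "a \<in> V" "adj u a" "\<not> adj v a" "adj a (f 0)"
    using \<open>end1 c\<close> f0 by (auto simp: end1_def)
  obtain b where b: "b \<in> V" "adj v b" "\<not> adj u b" "adj b (f k)"
    using \<open>end2 d\<close> fk by (auto simp: end2_def)
  have seg: "(f i, f j) \<in> E ^^ (j - i)" if "i \<le> j" "j \<le> k" for i j
    unfolding relpow_fun_conv using that step by (intro exI[of _ "\<lambda>l. f (i + l)"]) auto
  have fD: "(w, f i) \<in> E\<^sup>*" if "i \<le> k" for i
  proof -
    have "(f 0, f i) \<in> E\<^sup>*" using seg[of 0 i] that relpow_imp_rtrancl by auto
    then show ?thesis
      using \<open>end1 c\<close> f0 rtrancl_trans unfolding end1_def by metis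
  qed
  note fV = D[OF fD]
  have f_start: "\<not> end1 (f i)" if "0 < i" "i \<le> k" for i
    using min[of "k - i"] seg[of i k] \<open>end2 d\<close> that unfolding conn_def fk by auto
  have f_end: "\<not> end2 (f i)" if "i < k" for i
    using min[of i] seg[of 0 i] \<open>end1 c\<close> that unfolding conn_def f0 by auto
  have "induced_path k f"
    unfolding induced_path_def
  proof (intro conjI allI impI)
    show "f i \<in> V" if "i \<le> k" for i using fV that by simp
  next
    fix i j assume ij: "j \<le> k" "i < j"
    have consec: "(f i, f j) \<in> E" if "j = Suc i"
      using step ij that by simp
    have far: "\<not> adj (f i) (f j)" if "j \<noteq> Suc i"
    proof
      assume adj: "adj (f i) (f j)"
      show False
      proof (cases "f i = f j")
        case True
        \<comment> \<open>Cutting out the closed part from \<open>i\<close> to \<open>j\<close>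
          shortens the walk; a chord does the same in the other case.\<close>
        have "(f 0, f k) \<in> E ^^ (i + (k - j))"
          using seg[of 0 i] seg[of j k] ij True unfolding relpow_add by auto
        then show False
          using min[of "i + (k - j)"] ij \<open>end1 c\<close> \<open>end2 d\<close> unfolding conn_def f0 fk by auto
      next
        case False
        then have "(f i, f j) \<in> E" using adj fV[of i] fV[of j] ij by (auto simp: E_def)
        then have "(f 0, f k) \<in> E ^^ (Suc i + (k - j))"
          using seg[of 0 i] seg[of j k] ij unfolding relpow_add by auto
        then show False
          using min[of "Suc i + (k - j)"] ij that \<open>end1 c\<close> \<open>end2 d\<close> unfolding conn_def f0 fk by auto
      qed
    qed
    show "f i \<noteq> f j"
      using consec far adj_refl fV[of i] ij by (cases "j = Suc i") (auto simp: E_def)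
    show "adj (f i) (f j) \<longleftrightarrow> j = Suc i"
      using consec far by (auto simp: E_def)
  qed
  note f = this
  \<comment> \<open>If \<open>a\<close> were adjacent to \<open>f i\<close> with
    \<open>i > 0\<close>, the walk could start later and be shorter.\<close>
  have a_far: "\<not> adj a (f i)" if "0 < i" "i \<le> k" for i
    using f_start[OF that] fD[OF that(2)] a by (auto simp: end1_def)
  have b_far: "\<not> adj b (f i)" if "i < k" for i
    using f_end[OF that] fD[of i] that b by (auto simp: end2_def)
  have ne: "a \<noteq> u" "b \<noteq> v" "a \<noteq> v" "b \<noteq> u" "a \<noteq> b" "u \<noteq> v"
    using a b uv comm V adj_refl fV[of 0] fV[of k] by auto
  have f_ne: "a \<noteq> f i" "b \<noteq> f i" "u \<noteq> f i" "v \<noteq> f i" if "i \<le> k" for i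
    using a b fV[OF that] V adj_refl by auto
  have af: "induced_path (Suc k) (case_nat a f)"
    using f a ne f_ne a_far by (intro induced_path_Cons) auto
  have uaf: "induced_path (Suc (Suc k)) (case_nat u (case_nat a f))"
    using af a ne f_ne fV V by - (rule induced_path_Cons, auto split: nat.splits)
  have bf: "induced_path (Suc k) (case_nat b (\<lambda>i. f (k - i)))"
    using induced_path_rev[OF f] b ne f_ne b_far by (intro induced_path_Cons) auto
  have vbf: "induced_path (Suc (Suc k)) (case_nat v (case_nat b (\<lambda>i. f (k - i))))"
    using bf b ne f_ne fV V by - (rule induced_path_Cons, auto split: nat.splits)
  have "f 0 \<in> R u v"
  proof (cases "2 \<le> k")
    case True
    have "f 0 \<in> R u (f k)"
      using induced_path_mem(2)[OF uaf] True by (simp add: numeral_2_eq_2)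
    moreover have "f k \<in> R (f 0) v"
      using induced_path_mem(2)[OF vbf] True R_commute fV V by (simp add: numeral_2_eq_2)
    \<comment> \<open>(J4') demands this; for \<open>k \<le> 1\<close> the two vertices are adjacent
      or equal.\<close>
    moreover have "\<not> adj (f 0) (f k)"
      using induced_pathD(3)[OF f, of 0 k] True by simp
    ultimately show ?thesis
      using V fV uv comm by (intro mem_R_J4'[of u v "f 0" "f k"]) auto
  next
    case False
    \<comment> \<open>These are the membership hypotheses of (J4) for \<open>u, a, b, v\<close>. If
      \<open>a\<close> and \<open>b\<close> are non-adjacent, they come from extending the induced
      path \<open>b, f k, ..., f 0, a\<close> by \<open>v\<close> at one end or by \<open>u\<close>
      at the other.\<close>
    have "a \<in> R u b \<and> b \<in> R a v"
    proof (cases "adj a b")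
      case True
      then show ?thesis
        using a b ne f_ne V comm by (auto intro!: mem_R_J2)
    next
      case False
      define p where "p = case_nat b (\<lambda>i. case_nat a f (Suc k - i))"
      have p: "induced_path (Suc (Suc k)) p"
        unfolding p_def using induced_path_rev[OF af] a b ne f_ne b_far comm False
        by (intro induced_path_Cons) (auto split: nat.splits)
      have p_ends: "p 0 = b" "p (Suc (Suc k)) = a"
        by (simp_all add: p_def)
      have p_mid: "\<exists>j\<le>k. p i = f j" if "0 < i" "i < Suc (Suc k)" for i
        using that by (cases i) (auto simp: p_def Suc_diff_le intro!: exI[of _ "Suc k - i"])
      have "induced_path (Suc (Suc (Suc k))) (case_nat v p)"
        using p p_ends V b ne f_ne
      proof (intro induced_path_Cons)
        show "\<not> adj v (p i)" if "0 < i" "i \<le> Suc (Suc k)" for i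
          using that p_mid[of i] p_ends a fV by (cases "i = Suc (Suc k)") fastforce+
      qed auto
      from induced_path_mem(1)[OF this] have "b \<in> R v a"
        by (simp add: p_ends)
      moreover have "induced_path (Suc (Suc (Suc k))) (case_nat u (\<lambda>i. p (Suc (Suc k) - i)))"
        using induced_path_rev[OF p] p_ends V a ne f_ne
      proof (intro induced_path_Cons)
        show "\<not> adj u (p (Suc (Suc k) - i))" if "0 < i" "i \<le> Suc (Suc k)" for i
          using that p_mid[of "Suc (Suc k) - i"] p_ends b fV
          by (cases "i = Suc (Suc k)") fastforce+
      qed auto
      from induced_path_mem(1)[OF this] have "a \<in> R u b"
        by (simp add: p_ends)
      ultimately show ?thesis
        using R_commute a b V by auto
    qed
    then have "a \<in> R u v" "b \<in> R u v"
      using mem_R_J4[of u v a b] mem_R_J4[of v u b a] a b ne f_ne V comm uv R_commute by auto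
    \<comment> \<open>Both \<open>k = 0\<close> and \<open>k = 1\<close> fit (TW1'), whose
      \<open>z\<close> and \<open>w\<close> may coincide.\<close>
    moreover have "adj (f 0) (f k)"
      using False step[of 0] adj_refl fV[of 0] by (cases "k = 0") (auto simp: E_def not_le less_2_cases_iff)
    ultimately show ?thesis
      using V fV uv comm a b ne f_ne by (intro mem_R_TW1'[of u v a b "f 0" "f k"]) auto
  qed
  \<comment> \<open>(TW1') along the degenerate walk \<open>x, y, x, x\<close> passes membership
    from \<open>x\<close> to its neighbor \<open>y\<close> in the component.\<close>
  moreover have "x \<in> R u v" if "(f 0, x) \<in> E\<^sup>*" for x
    using that
  proof induction
    case base
    then show ?case using \<open>f 0 \<in> R u v\<close> .
  next
    case (step x y)
    then show ?case
      using V comm adj_refl by (intro mem_R_TW1'[of u v x x y x]) (auto simp: E_def)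
  qed
  ultimately show ?thesis using symE fD by blast
qed

text \<open>Along the walk to \<open>u\<close>, the first vertex adjacent to \<open>u\<close> serves
  as \<open>a\<close> and its predecessor as \<open>c\<close>; the walk keeps away from
  \<open>v\<close> throughout.\<close>

lemma remote_component_boundary:
  assumes V: "u \<in> V" "v \<in> V" "w \<in> V" and w: "\<not> adj u w" "\<not> adj v w"
    and walk: "(w, u) \<in> (remote_edges {v})\<^sup>*"
  obtains a c where "a \<in> V" "adj u a" "\<not> adj v a" "adj a c" "(w, c) \<in> (remote_edges {u, v})\<^sup>*"
proof -
  define E where "E = remote_edges {u, v}"
  have inE: "x \<in> V \<and> \<not> adj u x \<and> \<not> adj v x" if "(w, x) \<in> E\<^sup>*" for x
    using that V w by induction (auto simp: E_def remote_edges_def)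
  have "(w, x) \<in> E\<^sup>* \<or> (\<exists>a\<in>V. adj u a \<and> \<not> adj v a \<and> (\<exists>c. adj a c \<and> (w, c) \<in> E\<^sup>*))"
    if "(w, x) \<in> (remote_edges {v})\<^sup>*" for x
    using that
  proof induction
    case (step x y)
    show ?case
    proof (cases "(w, x) \<in> E\<^sup>* \<and> \<not> adj u y")
      case True
      with step.hyps(2) inE[of x] have "(x, y) \<in> E"
        by (auto simp: E_def remote_edges_def)
      with True show ?thesis by (meson rtrancl.rtrancl_into_rtrancl)
    next
      case False
      with step show ?thesis
        using adj_commute by (auto simp: remote_edges_def)
    qed
  qed simp
  \<comment> \<open>At \<open>x = u\<close> reflexivity of \<open>adj\<close> excludes the first
    alternative.\<close>
  from this[OF walk] inE[of u] adj_refl[OF V(1)] show thesis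
    using that by (auto simp: E_def)
qed

section \<open>Asteroidal triples\<close>

text \<open>Arcs join distinct vertices, so avoiding the neighbors of \<open>z\<close> does not by
  itself exclude \<open>z\<close>. But a path starting elsewhere would have to visit a neighbor of
  \<open>z\<close> just before reaching it.\<close>

lemma joined_avoiding_neighbors_imp_remote:
  assumes "joined_avoiding_neighbors (underlying_graph V R) x y z" "x \<noteq> z" "z \<in> V"
  shows "(x, y) \<in> (remote_edges {z})\<^sup>*" "\<not> adj z x" "\<not> adj z y"
proof -
  have arcs: "(s, t) \<in> parcs (underlying_graph V R) \<longleftrightarrow> s \<in> V \<and> t \<in> V \<and> s \<noteq> t \<and> adj s t" for s t
    by (simp add: underlying_graph_def adj_def)
  obtain p where p: "vwalk p (with_proj (underlying_graph V R))" "hd p = x" "last p = y"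
    and avoid: "\<forall>s\<in>set p. (z, s) \<notin> parcs (underlying_graph V R)"
    using assms(1) by (auto simp: joined_avoiding_neighbors_def vpath_def)
  have "(hd p, last p) \<in> (remote_edges {z})\<^sup>* \<and> \<not> adj z (hd p) \<and> \<not> adj z (last p)"
    using p(1) avoid \<open>x \<noteq> z\<close>[folded p(2)]
  proof (induction p rule: vwalk_induct)
    case (Base s)
    then show ?case using \<open>z \<in> V\<close> by (auto simp: underlying_graph_def adj_def)
  next
    case (Cons s t p)
    then have st: "s \<in> V" "t \<in> V" "s \<noteq> t" "adj s t"
      by (auto simp: arcs arcs_ends_def arc_to_ends_def)
    with Cons.prems \<open>z \<in> V\<close> have "t \<noteq> z" "\<not> adj z s"
      using adj_commute by (auto simp: arcs)
    with Cons st have "(s, t) \<in> remote_edges {z}"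
      by (auto simp: remote_edges_def)
    with Cons \<open>t \<noteq> z\<close> \<open>\<not> adj z s\<close> show ?case
      by (auto intro: converse_rtrancl_into_rtrancl)
  qed
  then show "(x, y) \<in> (remote_edges {z})\<^sup>*" "\<not> adj z x" "\<not> adj z y"
    using p by auto
qed

text \<open>Phrased by walks alone, so that any vertex of an asteroidal triple can take the place of
  \<open>w\<close>.\<close>

lemma mem_of_remote_walks:
  assumes V: "u \<in> V" "v \<in> V" "w \<in> V" and nonadj: "\<not> adj u v" "\<not> adj u w" "\<not> adj v w"
    and walks: "(w, u) \<in> (remote_edges {v})\<^sup>*" "(w, v) \<in> (remote_edges {u})\<^sup>*"
  shows "w \<in> R u v"
proof -
  obtain a c where a: "a \<in> V" "adj u a" "\<not> adj v a" "adj a c" "(w, c) \<in> (remote_edges {u, v})\<^sup>*"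
    using remote_component_boundary[OF V nonadj(2,3) walks(1)] .
  obtain b d where b: "b \<in> V" "adj v b" "\<not> adj u b" "adj b d" "(w, d) \<in> (remote_edges {v, u})\<^sup>*"
    using remote_component_boundary[OF V(2,1,3) nonadj(3,2) walks(2)] .
  show ?thesis
    using remote_component_mem[OF V a(1) b(1) nonadj a(2-5) b(2-4)] b(5)
    by (simp add: insert_commute)
qed

lemma AT_free_underlying_graph:
  assumes "axiom_b1' V R"
  shows "AT_free (underlying_graph V R)"
  unfolding AT_free_def
proof
  assume "\<exists>u v w. asteroidal_triple (underlying_graph V R) u v w"
  then obtain u v w where AT: "asteroidal_triple (underlying_graph V R) u v w" by blast
  then have V: "u \<in> V" "v \<in> V" "w \<in> V" and ne: "u \<noteq> v" "u \<noteq> w" "v \<noteq> w"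
    and joined: "joined_avoiding_neighbors (underlying_graph V R) u v w"
      "joined_avoiding_neighbors (underlying_graph V R) v w u"
      "joined_avoiding_neighbors (underlying_graph V R) u w v"
    by (auto simp: asteroidal_triple_def underlying_graph_def)
  note uv = joined_avoiding_neighbors_imp_remote[OF joined(1) ne(2) V(3)]
  note vw = joined_avoiding_neighbors_imp_remote[OF joined(2) ne(1)[symmetric] V(1)]
  note uw = joined_avoiding_neighbors_imp_remote[OF joined(3) ne(1) V(2)]
  have "w \<in> R u v"
    using uv vw uw V remote_edges_rtrancl_sym by (intro mem_of_remote_walks) auto
  moreover have "v \<in> R u w"
    using uv vw uw V remote_edges_rtrancl_sym by (intro mem_of_remote_walks) auto
  ultimately show False
    \<comment> \<open>(b1') is used with \<open>x = w\<close>; \<open>uw(3)\<close> is the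
      non-adjacency of \<open>v\<close> and \<open>w\<close>.\<close>
    using assms V ne uw(3) unfolding axiom_b1'_def adj_def by blast
qed

end

theorem theorem8:
  fixes V :: "'a set" and R :: "'a \<Rightarrow> 'a \<Rightarrow> 'a set"
  assumes "finite V" and "V \<noteq> {}"
    and "transit_function V R"
    and "axiom_b1' V R"
    and "axiom_J2 V R"
    and "axiom_J4 V R"
    and "axiom_J4' V R"
    and "axiom_TW1' V R"
  shows "AT_free (underlying_graph V R)"
proof -
  interpret transit_AT_axioms V R
    using assms by unfold_locales
  show ?thesis
    using assms(4) by (rule AT_free_underlying_graph)
qed

end
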